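(* Let $F(x)=\sum_{n>0} f(n)x^n$ be a formal power series with integer coefficients such that $f(1)=1$. Let $A(x)=\sum_{n>0}a(n)x^n$ be a formal power series with real coefficients and $a(1)=1$ satisfying the functional equation $$A(A(x))=\frac{F(4x)}{4}.$$ Then $A(x)$ has integer coefficients, i.e. $a(n)\in\mathbb{Z}$ for all $n\ge 1$.
   Context: Composition of power series is formal composition, and $\frac{F(4x)}{4}$ denotes the formal power series $\sum_{n>0}4^{n-1}f(n)x^n$. *)

theory Defs
  imports Complex_Main "HOL-Computational_Algebra.Formal_Power_Series"
begin

text \<open>The series \<open>F(4x)/4\<close>, for \<open>F\<close> an integer power series without constant term, viewed over
  the reals. The case distinction avoids the truncated exponent \<open>0 - 1\<close>.\<close>

definition scaled_by_four :: "int fps \<Rightarrow> real fps" where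
  "scaled_by_four F = Abs_fps (\<lambda>n. if n = 0 then 0 else 4 ^ (n - 1) * real_of_int (fps_nth F n))"

end

theory Submission
  imports Defs
begin

text \<open>
  For a series \<open>H\<close> let \<open>D\<^sub>H\<close> be the operator \<open>P \<mapsto> P \<circ> H - P\<close>. When \<open>H = x + \<dots>\<close>, it raises the
  order of \<open>P\<close>. Put \<open>G = F(4x)/4\<close>. From \<open>A \<circ> A = G\<close> we get \<open>D\<^sub>G = 2 D\<^sub>A + D\<^sub>A\<^sup>2\<close>, so \<open>D\<^sub>A/2\<close> is a
  solution \<open>y\<close> of \<open>y + y\<^sup>2 = D\<^sub>G/4\<close>, which can be solved for \<open>y\<close> over the integers. The series
  \<open>D\<^sub>G\<^sup>m x\<close> arises from the integral series \<open>D\<^sub>F\<^sup>m x\<close>, of order at least \<open>m + 1\<close>, by the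
  substitution \<open>P(x) \<mapsto> P(4x)/4\<close>; hence it is divisible by \<open>4\<^sup>m\<close>. It follows that
  \<open>A = x + D\<^sub>A x\<close> is integral.
\<close>

definition compose_diff :: "'a::comm_ring_1 fps \<Rightarrow> 'a fps \<Rightarrow> 'a fps" where
  "compose_diff H P = fps_compose P H - P"

lemma compose_diff_add: "compose_diff H (P + Q) = compose_diff H P + compose_diff H Q"
  by (simp add: compose_diff_def fps_compose_add_distrib)

lemma compose_diff_funpow_add:
  "(compose_diff H ^^ m) (P + Q) = (compose_diff H ^^ m) P + (compose_diff H ^^ m) Q"
  by (induction m) (simp_all add: compose_diff_add)

lemma compose_diff_compose_self:
  fixes A :: "'a::idom fps"
  assumes "fps_nth A 0 = 0"
  shows "compose_diff (fps_compose A A) P =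
    compose_diff A P + compose_diff A P + compose_diff A (compose_diff A P)"
  using assms
  by (simp add: compose_diff_def fps_compose_assoc fps_compose_sub_distrib)

text \<open>Each power \<open>H ^ i\<close> starts with x^i, with coefficient 1, so composing with
  \<open>H\<close> leaves the coefficients of \<open>P\<close> up to degree \<open>m\<close>
  unchanged.\<close>

lemma compose_diff_raises_order:
  fixes H P :: "'a::idom fps"
  assumes H: "fps_nth H 0 = 0" "fps_nth H 1 = 1"
    and P: "\<And>i. i < m \<Longrightarrow> fps_nth P i = 0"
    and n: "n \<le> m"
  shows "fps_nth (compose_diff H P) n = 0"
proof -
  have "fps_nth (fps_compose P H) n = (\<Sum>i\<in>{0..n}. fps_nth P i * fps_nth (H ^ i) n)"
    by (simp add: fps_compose_nth)
  also have "\<dots> = (\<Sum>i\<in>{0..n}. if i = n then fps_nth P n else 0)"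
    using P n startsby_zero_power_nth_same[OF H(1)] H(2) by (intro sum.cong) auto
  also have "\<dots> = fps_nth P n"
    by simp
  finally show ?thesis
    by (simp add: compose_diff_def)
qed

lemma compose_diff_funpow_raises_order:
  fixes H P :: "'a::idom fps"
  assumes H: "fps_nth H 0 = 0" "fps_nth H 1 = 1"
    and P: "\<And>i. i < l \<Longrightarrow> fps_nth P i = 0"
    and "n < l + m"
  shows "fps_nth ((compose_diff H ^^ m) P) n = 0"
  using \<open>n < l + m\<close>
proof (induction m arbitrary: n)
  case 0
  then show ?case by (simp add: P)
next
  case (Suc m)
  then show ?case
    using compose_diff_raises_order[OF H, of "l + m"] by simp
qed

lemma scaled_by_four_nth:
  assumes "fps_nth F 0 = 0"
  shows "fps_nth (scaled_by_four F) n = 4 ^ n / 4 * real_of_int (fps_nth F n)"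
  using assms by (cases n) (simp_all add: scaled_by_four_def)

lemma scaled_by_four_power_nth:
  assumes "fps_nth F 0 = 0"
  shows "fps_nth (scaled_by_four F ^ i) n = 4 ^ n / 4 ^ i * real_of_int (fps_nth (F ^ i) n)"
proof (induction i arbitrary: n)
  case 0
  then show ?case by simp
next
  case (Suc i)
  have "fps_nth (scaled_by_four F ^ Suc i) n =
      (\<Sum>j=0..n. 4 ^ j / 4 * real_of_int (fps_nth F j) *
        (4 ^ (n - j) / 4 ^ i * real_of_int (fps_nth (F ^ i) (n - j))))"
    by (simp add: fps_mult_nth Suc.IH scaled_by_four_nth[OF assms])
  also have "\<dots> = (\<Sum>j=0..n. 4 ^ n / 4 ^ Suc i *
        real_of_int (fps_nth F j * fps_nth (F ^ i) (n - j)))"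
  proof (intro sum.cong refl)
    fix j assume "j \<in> {0..n}"
    then have "(4::real) ^ n = 4 ^ j * 4 ^ (n - j)"
      by (simp flip: power_add)
    then show "4 ^ j / 4 * real_of_int (fps_nth F j) *
        (4 ^ (n - j) / 4 ^ i * real_of_int (fps_nth (F ^ i) (n - j))) =
        4 ^ n / 4 ^ Suc i * real_of_int (fps_nth F j * fps_nth (F ^ i) (n - j))"
      by simp
  qed
  also have "\<dots> = 4 ^ n / 4 ^ Suc i * real_of_int (fps_nth (F ^ Suc i) n)"
    by (simp add: fps_mult_nth sum_distrib_left)
  finally show ?case .
qed

text \<open>The map P(x) -> P(4x)/4 is conjugation by the scaling x -> 4x, hence respects
  composition.\<close>

lemma scaled_by_four_compose:
  assumes "fps_nth P 0 = 0" "fps_nth F 0 = 0"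
  shows "fps_compose (scaled_by_four P) (scaled_by_four F) = scaled_by_four (fps_compose P F)"
proof (rule fps_ext)
  fix n
  have 0: "fps_nth (fps_compose P F) 0 = 0"
    using assms by simp
  have "fps_nth (fps_compose (scaled_by_four P) (scaled_by_four F)) n =
      (\<Sum>i=0..n. 4 ^ n / 4 * real_of_int (fps_nth P i * fps_nth (F ^ i) n))"
    by (simp add: fps_compose_nth scaled_by_four_nth assms scaled_by_four_power_nth mult_ac)
  also have "\<dots> = fps_nth (scaled_by_four (fps_compose P F)) n"
    unfolding scaled_by_four_nth[OF 0] by (simp add: fps_compose_nth sum_distrib_left)
  finally show "fps_nth (fps_compose (scaled_by_four P) (scaled_by_four F)) n =
      fps_nth (scaled_by_four (fps_compose P F)) n" .
qed

lemma scaled_by_four_diff: "scaled_by_four (P - Q) = scaled_by_four P - scaled_by_four Q"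
  by (rule fps_ext) (simp add: scaled_by_four_def algebra_simps)

lemma scaled_by_four_X: "scaled_by_four fps_X = fps_X"
  by (rule fps_ext) (simp add: scaled_by_four_def)

lemma compose_diff_scaled_by_four_X:
  assumes F: "fps_nth F 0 = 0" "fps_nth F 1 = 1"
  shows "(compose_diff (scaled_by_four F) ^^ m) fps_X =
    scaled_by_four ((compose_diff F ^^ m) fps_X)"
proof (induction m)
  case 0
  then show ?case by (simp add: scaled_by_four_X)
next
  case (Suc m)
  have "fps_nth ((compose_diff F ^^ m) fps_X) 0 = 0"
    by (rule compose_diff_funpow_raises_order[OF F, of 1]) auto
  then show ?case
    using F by (simp add: Suc.IH compose_diff_def[of _ "scaled_by_four _"]
        compose_diff_def[of F "(compose_diff F ^^ m) fps_X"]
        scaled_by_four_compose scaled_by_four_diff)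
qed

text \<open>Coefficients below degree \<open>m + 1\<close> vanish; from there on the factor
  \<open>4 ^ (n - 1)\<close> is a multiple of \<open>4 ^ m\<close>.\<close>

lemma compose_diff_scaled_by_four_X_Ints:
  assumes F: "fps_nth F 0 = 0" "fps_nth F 1 = 1"
  shows "fps_nth ((compose_diff (scaled_by_four F) ^^ m) fps_X) n / 4 ^ m \<in> \<int>"
proof (cases "n < Suc m")
  case True
  then have "fps_nth ((compose_diff F ^^ m) fps_X) n = 0"
    by (intro compose_diff_funpow_raises_order[OF F, of 1]) auto
  then show ?thesis
    unfolding compose_diff_scaled_by_four_X[OF F] by (simp add: scaled_by_four_def)
next
  case False
  then obtain k where "n = Suc (m + k)"
    using less_iff_Suc_add by (metis not_less_eq)
  then show ?thesis
    unfolding compose_diff_scaled_by_four_X[OF F] by (simp add: scaled_by_four_def power_add)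
qed

text \<open>Mixed iterates make the induction close: for the quotients u(m,j), the operator identity
  becomes u(m,j+1) = u(m+1,j) - u(m,j+2), free of denominators.\<close>

lemma compose_diff_half_iterate_Ints:
  fixes F :: "int fps" and A :: "real fps"
  assumes F: "fps_nth F 0 = 0" "fps_nth F 1 = 1"
    and A: "fps_nth A 0 = 0" "fps_nth A 1 = 1"
    and AA: "fps_compose A A = scaled_by_four F"
  defines "v \<equiv> \<lambda>m j. (compose_diff (scaled_by_four F) ^^ m) ((compose_diff A ^^ j) fps_X)"
  shows "fps_nth (v m j) n / (4 ^ m * 2 ^ j) \<in> \<int>"
proof -
  have G: "fps_nth (scaled_by_four F) 0 = 0" "fps_nth (scaled_by_four F) 1 = 1"
    using F by (simp_all add: scaled_by_four_def)
  \<comment> \<open>The series x has order 1, and each of the \<open>m + j\<close> operators raises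
    the order.\<close>
  have low: "fps_nth (v m j) n = 0" if "n \<le> m + j" for m j
    unfolding v_def
  proof (rule compose_diff_funpow_raises_order[OF G, of "1 + j"])
    show "fps_nth ((compose_diff A ^^ j) fps_X) i = 0" if "i < 1 + j" for i
      using that by (intro compose_diff_funpow_raises_order[OF A, of 1]) auto
  qed (use that in auto)
  have rec: "v (Suc m) j = v m (Suc j) + v m (Suc j) + v m (Suc (Suc j))" for m j
    unfolding v_def funpow_Suc_right[of m] comp_apply
      compose_diff_compose_self[OF A(1), unfolded AA] compose_diff_funpow_add
    by simp
  show ?thesis
  \<comment> \<open>A downward induction on \<open>m + j\<close>, anchored where \<open>low\<close>
    gives zero.\<close>
  proof (induction "n - (m + j)" arbitrary: m j rule: less_induct)
    case less
    \<comment> \<open>Of the two series that determine \<open>v m (Suc j)\<close> by \<open>rec\<close>, the series \<open>v (Suc m) j\<close> has the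
      same value of \<open>m + j\<close>, so it is reached by an inner induction on \<open>j\<close>.\<close>
    have "fps_nth (v m' j') n / (4 ^ m' * 2 ^ j') \<in> \<int>" if "m' + j' = m + j" for m' j'
      using that
    proof (induction j' arbitrary: m')
      case 0
      show ?case
        using compose_diff_scaled_by_four_X_Ints[OF F] by (simp add: v_def)
    next
      case (Suc j')
      show ?case
      \<comment> \<open>The truncated difference \<open>n - (m + j)\<close> drops when
        \<open>m + j\<close> grows by one only if \<open>m + j < n\<close>.\<close>
      proof (cases "n \<le> m + j")
        case True
        then show ?thesis
          using Suc.prems by (simp add: low)
      next
        case False
        have "fps_nth (v (Suc m') j') n / (4 ^ Suc m' * 2 ^ j') \<in> \<int>"
          using Suc.prems by (intro Suc.IH) simp
        moreover have "fps_nth (v m' (Suc (Suc j'))) n / (4 ^ m' * 2 ^ Suc (Suc j')) \<in> \<int>"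
          using False Suc.prems by (intro less.hyps) simp
        moreover have "fps_nth (v m' (Suc j')) n / (4 ^ m' * 2 ^ Suc j') =
            fps_nth (v (Suc m') j') n / (4 ^ Suc m' * 2 ^ j') -
            fps_nth (v m' (Suc (Suc j'))) n / (4 ^ m' * 2 ^ Suc (Suc j'))"
          unfolding rec fps_add_nth by (simp add: field_simps)
        ultimately show ?thesis
          by simp
      qed
    qed
    then show ?case by simp
  qed
qed

theorem corollary7:
  fixes F :: "int fps" and A :: "real fps"
  assumes "fps_nth F 0 = 0" and "fps_nth F 1 = 1"
    and "fps_nth A 0 = 0" and "fps_nth A 1 = 1"
    and "fps_compose A A = scaled_by_four F"
  shows "\<forall>n\<ge>1. fps_nth A n \<in> \<int>"
proof (intro allI impI)
  fix n :: nat
  \<comment> \<open>The series here is A - x, so its coefficients are even integers.\<close>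
  have "fps_nth (compose_diff A fps_X) n / 2 \<in> \<int>"
    using compose_diff_half_iterate_Ints[OF assms, of 0 1] by simp
  then have "2 * (fps_nth (compose_diff A fps_X) n / 2) + fps_nth fps_X n \<in> \<int>"
    by (intro Ints_add Ints_mult) auto
  moreover have "2 * (fps_nth (compose_diff A fps_X) n / 2) + fps_nth fps_X n = fps_nth A n"
    using assms(3) by (simp add: compose_diff_def field_simps)
  ultimately show "fps_nth A n \<in> \<int>"
    by (simp only:)
qed

end
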